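(* Let $\alpha>-1$, $\beta>-1$ be real numbers and let $n$ be a positive integer. For all integers $k,l$ with $1\le k,l\le n$, $$\int_0^{\infty} e^{-\alpha t}(1-e^{-t})^\beta\,{\cal E}_{nk}^{(\alpha,\beta)}(t)\,{\cal E}_{nl}^{(\alpha,\beta)}(t)\,dt=\frac{1}{\alpha+2k}\,\frac{\Gamma(\alpha+n+k+1)\,\Gamma(\beta+n-k+1)}{(n-k)!\,\Gamma(\alpha+\beta+n+k+1)}\,\delta_{kl}.$$
   Context: For integers $0\le k\le n$ and real $\alpha,\beta$, the alternative Jacobi polynomials are given by $${\cal P}_{nk}^{(\alpha,\beta)}(x)=\frac{x^{-\alpha-k-1}(1-x)^{-\beta}}{(n-k)!}\frac{d^{\,n-k}}{dx^{\,n-k}}\left(x^{\alpha+n+k+1}(1-x)^{\beta+n-k}\right),\qquad 0<x<1,$$ (the restriction of) a polynomial in $x$; the formula is used here also when the first parameter lies in $(-2,-1]$. The orthogonal exponential polynomials on $[0,\infty)$ are defined, for $1\le k\le n$, by $${\cal E}_{nk}^{(\alpha,\beta)}(t)={\cal P}_{nk}^{(\alpha-1,\beta)}(e^{-t}).$$ $\delta_{kl}$ is the Kronecker delta and $\Gamma$ the gamma function. *)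

theory Defs
  imports "HOL-Analysis.Analysis"
begin

definition alt_jacobi_formula :: "nat \<Rightarrow> nat \<Rightarrow> real \<Rightarrow> real \<Rightarrow> real \<Rightarrow> real" where
  "alt_jacobi_formula n k \<alpha> \<beta> x =
     x powr (- \<alpha> - real k - 1) * (1 - x) powr (- \<beta>) / fact (n - k) *
     (deriv ^^ (n - k)) (\<lambda>y. y powr (\<alpha> + real n + real k + 1) * (1 - y) powr (\<beta> + real n - real k)) x"

text \<open>
  The Rodrigues-type formula is meaningful only for \<open>0 < x < 1\<close>; the alternative Jacobi polynomial
  is the polynomial that agrees with it there. It exists and is unique for \<open>k \<le> n\<close> and all real
  parameters, see \<open>alt_jacobi_ex1\<close> below, so \<open>poly_alt_jacobi\<close> determines it.
\<close>
definition alt_jacobi :: "nat \<Rightarrow> nat \<Rightarrow> real \<Rightarrow> real \<Rightarrow> real poly" where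
  "alt_jacobi n k \<alpha> \<beta> = (THE p. \<forall>x\<in>{0<..<1}. poly p x = alt_jacobi_formula n k \<alpha> \<beta> x)"

definition exp_jacobi :: "nat \<Rightarrow> nat \<Rightarrow> real \<Rightarrow> real \<Rightarrow> real \<Rightarrow> real" where
  "exp_jacobi n k \<alpha> \<beta> t = poly (alt_jacobi n k (\<alpha> - 1) \<beta>) (exp (- t))"

lemma iterated_deriv_powr:
  fixes a b :: real
  shows "\<exists>q::real poly. \<forall>x\<in>{0<..<1}.
    (deriv ^^ m) (\<lambda>y. y powr a * (1 - y) powr b) x =
      x powr (a - real m) * (1 - x) powr (b - real m) * poly q x"
proof (induction m)
  case 0
  show ?case by (rule exI[of _ 1]) simp
next
  case (Suc m)
  let ?f = "(deriv ^^ m) (\<lambda>y. y powr a * (1 - y) powr b)"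
  from Suc.IH obtain q :: "real poly" where
    q: "\<And>x. x \<in> {0<..<1} \<Longrightarrow> ?f x = x powr (a - real m) * (1 - x) powr (b - real m) * poly q x"
    by blast
  define r where "r = smult (a - real m) ([:1, -1:] * q) - smult (b - real m) ([:0, 1:] * q)
     + [:0, 1:] * [:1, -1:] * pderiv q"
  have "deriv ?f x = x powr (a - real (Suc m)) * (1 - x) powr (b - real (Suc m)) * poly r x"
    if x: "x \<in> {0<..<1}" for x
  proof -
    define c d where "c = a - real m" and "d = b - real m"
    have ev: "\<forall>\<^sub>F y in nhds x. ?f y = y powr c * (1 - y) powr d * poly q y"
      using eventually_nhds_in_open[of "{0<..<1}" x] x q
      by (auto elim!: eventually_mono simp: c_def d_def)
    have p1: "x powr c = x powr (c - 1) * x" and p2: "(1 - x) powr d = (1 - x) powr (d - 1) * (1 - x)"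
      using x by (simp_all add: powr_diff)
    have "((\<lambda>y. y powr c * (1 - y) powr d * poly q y) has_real_derivative
        x powr c * (1 - x) powr d * poly (pderiv q) x
        + (x powr c * (- (d * (1 - x) powr (d - 1))) + c * x powr (c - 1) * (1 - x) powr d) * poly q x) (at x)"
      using x by (auto intro!: derivative_eq_intros poly_DERIV simp: algebra_simps)
    also have "x powr c * (1 - x) powr d * poly (pderiv q) x
        + (x powr c * (- (d * (1 - x) powr (d - 1))) + c * x powr (c - 1) * (1 - x) powr d) * poly q x
        = x powr (c - 1) * (1 - x) powr (d - 1) * poly r x"
      unfolding p1 p2 r_def by (simp add: c_def d_def algebra_simps)
    finally have "deriv (\<lambda>y. y powr c * (1 - y) powr d * poly q y) x
        = x powr (c - 1) * (1 - x) powr (d - 1) * poly r x"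
      by (rule DERIV_imp_deriv)
    with deriv_cong_ev[OF ev refl] show ?thesis
      by (simp add: c_def d_def algebra_simps)
  qed
  then show ?case by (intro exI[of _ r]) simp
qed

lemma alt_jacobi_ex1:
  assumes "k \<le> n"
  shows "\<exists>!p. \<forall>x\<in>{0<..<1}. poly p x = alt_jacobi_formula n k \<alpha> \<beta> x"
proof (rule ex_ex1I)
  obtain q :: "real poly" where q: "\<And>x. x \<in> {0<..<1} \<Longrightarrow>
      (deriv ^^ (n - k)) (\<lambda>y. y powr (\<alpha> + real n + real k + 1) * (1 - y) powr (\<beta> + real n - real k)) x =
      x powr (\<alpha> + real n + real k + 1 - real (n - k)) * (1 - x) powr (\<beta> + real n - real k - real (n - k)) * poly q x"
    using iterated_deriv_powr by blast
  have "poly (smult (1 / fact (n - k)) (monom 1 k * q)) x = alt_jacobi_formula n k \<alpha> \<beta> x"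
    if x: "x \<in> {0<..<1}" for x
  proof -
    have e: "\<alpha> + real n + real k + 1 - real (n - k) = \<alpha> + real k + 1 + real k"
        "\<beta> + real n - real k - real (n - k) = \<beta>"
      using assms by (simp_all add: of_nat_diff)
    have "x powr (- \<alpha> - real k - 1) * x powr (\<alpha> + real k + 1 + real k) = x ^ k"
      using x by (simp add: powr_add[symmetric] powr_realpow)
    moreover have "(1 - x) powr (- \<beta>) * (1 - x) powr \<beta> = 1"
      using x by (simp add: powr_add[symmetric])
    moreover have "A * B / f * (C * D * r) = (A * C) * (B * D) * r / f" for A B C D f r :: real
      by simp
    ultimately have "alt_jacobi_formula n k \<alpha> \<beta> x = x ^ k * 1 * poly q x / fact (n - k)"
      unfolding alt_jacobi_formula_def q[OF x] e by (simp only:)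
    then show ?thesis by (simp add: poly_monom)
  qed
  then show "\<exists>p. \<forall>x\<in>{0<..<1}. poly p x = alt_jacobi_formula n k \<alpha> \<beta> x" by blast
next
  fix p q :: "real poly"
  assume "\<forall>x\<in>{0<..<1}. poly p x = alt_jacobi_formula n k \<alpha> \<beta> x"
    and "\<forall>x\<in>{0<..<1}. poly q x = alt_jacobi_formula n k \<alpha> \<beta> x"
  then have "{0<..<1} \<subseteq> {x. poly (p - q) x = 0}" by auto
  moreover have "infinite {0<..<1::real}" by simp
  ultimately have "p - q = 0"
    using poly_roots_finite finite_subset by metis
  then show "p = q" by simp
qed

lemma poly_alt_jacobi:
  assumes "k \<le> n" "0 < x" "x < 1"
  shows "poly (alt_jacobi n k \<alpha> \<beta>) x = alt_jacobi_formula n k \<alpha> \<beta> x"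
  using theI'[OF alt_jacobi_ex1[OF assms(1)], of \<alpha> \<beta>] assms(2,3)
  unfolding alt_jacobi_def by simp

end

theory Submission
  imports Defs
begin

text \<open>
  With \<open>x = exp (- t)\<close> the integral becomes one over \<open>0 < x < 1\<close> with weight
  \<open>x powr (\<alpha> - 1) * (1 - x) powr \<beta>\<close>, and the \<open>k\<close>-th polynomial is \<open>x ^ k\<close> times a polynomial of
  degree at most \<open>n - k\<close>. For \<open>k \<le> l\<close>, the Rodrigues formula for index \<open>k\<close> turns the integrand into
  \<open>R x / x\<close> times the \<open>(n - k)\<close>-th derivative of \<open>x powr a * (1 - x) powr b\<close>, where \<open>R\<close> has degree at
  most \<open>n - k\<close>. Integrating by parts \<open>n - k\<close> times annihilates every monomial of \<open>R x / x\<close> except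
  \<open>1 / x\<close>, so only the constant coefficient of \<open>R\<close> survives, times a Beta integral; that
  coefficient vanishes for \<open>k < l\<close>.
\<close>

section \<open>The polynomial factor in the Rodrigues formula\<close>

text \<open>Up to sign, a factor \<open>fact m\<close> and an affine change of variable, a Jacobi
  polynomial with exponents \<open>a - m\<close> at 0 and \<open>b - m\<close> at 1. The recursion
  is the product rule, each derivative using up one power of \<open>x\<close> and one of
  \<open>1 - x\<close>. It gives access to the degree and the value at 0, which
  \<open>iterated_deriv_powr\<close> does not reveal.\<close>

primrec rodrigues_poly :: "real \<Rightarrow> real \<Rightarrow> nat \<Rightarrow> real poly" where
  "rodrigues_poly a b 0 = 1"
| "rodrigues_poly a b (Suc m) =
     smult (a - real m) ([:1, -1:] * rodrigues_poly a b m)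
     - smult (b - real m) ([:0, 1:] * rodrigues_poly a b m)
     + [:0, 1:] * ([:1, -1:] * pderiv (rodrigues_poly a b m))"

lemma degree_rodrigues_poly: "degree (rodrigues_poly a b m) \<le> m"
proof (induction m)
  case (Suc m)
  let ?q = "rodrigues_poly a b m"
  have lin: "degree ([:c, d:] * p) \<le> Suc (degree p)" for c d :: real and p
    using degree_mult_le[of "[:c, d:]" p] degree_pCons_le[of c "[:d:]"] by simp
  have "degree (smult c ([:d, e:] * ?q)) \<le> Suc m" for c d e
    using degree_smult_le[of c "[:d, e:] * ?q"] lin[of d e ?q] Suc by linarith
  moreover have "degree ([:0, 1:] * ([:1, -1:] * pderiv ?q)) \<le> Suc m"
  \<comment> \<open>Two linear factors raise the degree by 2; \<open>pderiv\<close> takes 1 back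
    only when the degree is positive, so constants are treated apart.\<close>
  proof (cases "degree ?q = 0")
    case True
    then have "pderiv ?q = 0" by (simp add: pderiv_eq_0_iff)
    then show ?thesis by simp
  next
    case False
    then show ?thesis
      using lin[of 0 1 "[:1, -1:] * pderiv ?q"] lin[of 1 "-1" "pderiv ?q"] degree_pderiv[of ?q] Suc
      by linarith
  qed
  ultimately show ?case
    unfolding rodrigues_poly.simps by (intro degree_add_le degree_diff_le)
qed simp

text \<open>At 0 only the first summand of the recursion survives.\<close>

lemma poly_0_rodrigues_poly: "poly (rodrigues_poly a b m) 0 = (\<Prod>i<m. a - real i)"
  by (induction m) (simp_all add: mult.commute)

lemma DERIV_rodrigues:
  fixes a b :: real
  assumes "0 < x" "x < 1"
  shows "((\<lambda>y. y powr (a - real m) * (1 - y) powr (b - real m) * poly (rodrigues_poly a b m) y)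
    has_real_derivative
      x powr (a - real (Suc m)) * (1 - x) powr (b - real (Suc m)) * poly (rodrigues_poly a b (Suc m)) x)
    (at x)"
proof -
  define c d q where "c = a - real m" and "d = b - real m" and "q = rodrigues_poly a b m"
  have p1: "x powr c = x powr (c - 1) * x" and p2: "(1 - x) powr d = (1 - x) powr (d - 1) * (1 - x)"
    using assms by (simp_all add: powr_diff)
  have "((\<lambda>y. y powr c * (1 - y) powr d * poly q y) has_real_derivative
      x powr c * (1 - x) powr d * poly (pderiv q) x
      + (x powr c * (- (d * (1 - x) powr (d - 1))) + c * x powr (c - 1) * (1 - x) powr d) * poly q x) (at x)"
    using assms by (auto intro!: derivative_eq_intros poly_DERIV simp: algebra_simps)
  also have "x powr c * (1 - x) powr d * poly (pderiv q) x
      + (x powr c * (- (d * (1 - x) powr (d - 1))) + c * x powr (c - 1) * (1 - x) powr d) * poly q x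
      = x powr (c - 1) * (1 - x) powr (d - 1) * poly (rodrigues_poly a b (Suc m)) x"
    unfolding p1 p2 by (simp add: c_def d_def q_def algebra_simps)
  finally show ?thesis
    by (simp add: c_def d_def q_def algebra_simps)
qed

lemma iterated_deriv_eq_rodrigues_poly:
  fixes a b :: real
  assumes "0 < x" "x < 1"
  shows "(deriv ^^ m) (\<lambda>y. y powr a * (1 - y) powr b) x =
    x powr (a - real m) * (1 - x) powr (b - real m) * poly (rodrigues_poly a b m) x"
  using assms
proof (induction m arbitrary: x)
  case (Suc m)
  have "\<forall>\<^sub>F y in nhds x. y \<in> {0<..<1}"
    using Suc.prems by (intro eventually_nhds_in_open) auto
  then have "\<forall>\<^sub>F y in nhds x. (deriv ^^ m) (\<lambda>y. y powr a * (1 - y) powr b) y =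
      y powr (a - real m) * (1 - y) powr (b - real m) * poly (rodrigues_poly a b m) y"
    by (rule eventually_mono) (use Suc.IH in auto)
  from deriv_cong_ev[OF this refl] DERIV_imp_deriv[OF DERIV_rodrigues[OF Suc.prems]]
  show ?case by simp
qed simp

lemma poly_alt_jacobi_rodrigues:
  assumes "k \<le> n" "0 < x" "x < 1"
  shows "poly (alt_jacobi n k (\<alpha> - 1) \<beta>) x =
    x ^ k * poly (rodrigues_poly (\<alpha> + real n + real k) (\<beta> + real n - real k) (n - k)) x / fact (n - k)"
proof -
  let ?Q = "poly (rodrigues_poly (\<alpha> + real n + real k) (\<beta> + real n - real k) (n - k)) x"
  have e: "\<alpha> - 1 + real n + real k + 1 = \<alpha> + real n + real k"
      "\<alpha> + real n + real k - real (n - k) = \<alpha> + 2 * real k"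
      "\<beta> + real n - real k - real (n - k) = \<beta>"
      "- (\<alpha> - 1) - real k - 1 = - \<alpha> - real k"
    using assms by (simp_all add: of_nat_diff)
  have 1: "x powr (- \<alpha> - real k) * x powr (\<alpha> + 2 * real k) = x ^ k"
    using assms by (simp add: powr_add[symmetric] powr_realpow)
  have 2: "(1 - x) powr (- \<beta>) * (1 - x) powr \<beta> = 1"
    using assms by (simp add: powr_add[symmetric])
  have "poly (alt_jacobi n k (\<alpha> - 1) \<beta>) x =
      x powr (- \<alpha> - real k) * (1 - x) powr (- \<beta>) / fact (n - k) *
      (x powr (\<alpha> + 2 * real k) * (1 - x) powr \<beta> * ?Q)"
    unfolding poly_alt_jacobi[OF assms] alt_jacobi_formula_def e(1,4)
      iterated_deriv_eq_rodrigues_poly[OF assms(2,3)] e(2,3) ..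
  also have "\<dots> = (x powr (- \<alpha> - real k) * x powr (\<alpha> + 2 * real k)) *
      ((1 - x) powr (- \<beta>) * (1 - x) powr \<beta>) * ?Q / fact (n - k)"
    by simp
  finally show ?thesis by (simp add: 1 2)
qed

section \<open>Integration by parts against the Rodrigues derivative\<close>

text \<open>The integrand is \<open>x powr c\<close> times an \<open>m\<close>-th derivative. Each
  integration by parts moves one derivative onto \<open>x powr c\<close>, which produces the falling
  factorial of \<open>c\<close>; a Beta integral is left.\<close>

lemma has_integral_rodrigues_moment:
  fixes a b c :: real
  assumes "c + a - real m > -1" "b - real m > -1"
  shows "((\<lambda>x. x powr (c + a - real m) * (1 - x) powr (b - real m) * poly (rodrigues_poly a b m) x)
    has_integral (-1) ^ m * (\<Prod>i<m. c - real i) * Beta (c + a - real m + 1) (b + 1)) {0<..<1}"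
  using assms
proof (induction m arbitrary: c)
  case 0
  then show ?case
    using has_integral_Beta_real[of "c + a + 1" "b + 1"] by (simp add: has_integral_Icc_iff_Ioo)
next
  case (Suc m)
  let ?g = "\<lambda>m x. x powr (a - real m) * (1 - x) powr (b - real m) * poly (rodrigues_poly a b m) x"
  \<comment> \<open>The powers of \<open>x\<close> are merged because \<open>c\<close> alone may be
    negative (it is -1 in the decisive case); continuity at 0 depends only on the sum of the
    exponents.\<close>
  let ?F = "\<lambda>c m x. x powr (c + a - real m) * (1 - x) powr (b - real m) * poly (rodrigues_poly a b m) x"
  have F: "?F c m x = x powr c * ?g m x" if "0 < x" for c m x
    using that by (simp add: powr_add powr_diff)
  have "((\<lambda>x. ?F c (Suc m) x + c * ?F (c - 1) m x) has_integral ?F c m 1 - ?F c m 0) {0..1}"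
  proof (rule fundamental_theorem_of_calculus_interior)
    show "continuous_on {0..1} (?F c m)"
      using Suc.prems by (intro continuous_intros continuous_on_powr') auto
    fix x :: real assume "x \<in> {0<..<1}"
    then have x: "0 < x" "x < 1" by auto
    have "((\<lambda>y. y powr c * ?g m y) has_real_derivative
        c * x powr (c - 1) * ?g m x + ?g (Suc m) x * x powr c) (at x)"
      using x by (intro DERIV_mult DERIV_rodrigues has_real_derivative_powr)
    moreover have "\<forall>\<^sub>F y in nhds x. y \<in> {0<..}"
      using x by (intro eventually_nhds_in_open) auto
    then have "\<forall>\<^sub>F y in nhds x. ?F c m y = y powr c * ?g m y"
      by (rule eventually_mono) (rule F, simp)
    ultimately have "(?F c m has_real_derivative
        c * x powr (c - 1) * ?g m x + ?g (Suc m) x * x powr c) (at x)"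
      by (subst DERIV_cong_ev[OF refl _ refl])
    also have "c * x powr (c - 1) * ?g m x + ?g (Suc m) x * x powr c =
        ?F c (Suc m) x + c * ?F (c - 1) m x"
      unfolding F[OF x(1)] by (simp only: ac_simps)
    finally show "(?F c m has_vector_derivative ?F c (Suc m) x + c * ?F (c - 1) m x) (at x)"
      by (simp only: has_real_derivative_iff_has_vector_derivative)
  qed simp
  \<comment> \<open>The hypotheses for \<open>Suc m\<close> make both exponents at level
    \<open>m\<close> positive, so the boundary terms vanish.\<close>
  moreover have "?F c m 1 - ?F c m 0 = 0" using Suc.prems by simp
  ultimately have "((\<lambda>x. ?F c (Suc m) x + c * ?F (c - 1) m x) has_integral 0) {0<..<1}"
    by (simp only: has_integral_Icc_iff_Ioo)
  moreover have "(?F (c - 1) m has_integral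
      (-1) ^ m * (\<Prod>i<m. c - 1 - real i) * Beta (c - 1 + a - real m + 1) (b + 1)) {0<..<1}"
    using Suc.prems by (intro Suc.IH) auto
  note has_integral_mult_right[OF this, of c]
  ultimately have "((\<lambda>x. ?F c (Suc m) x + c * ?F (c - 1) m x - c * ?F (c - 1) m x) has_integral
      0 - c * ((-1) ^ m * (\<Prod>i<m. c - 1 - real i) * Beta (c - 1 + a - real m + 1) (b + 1))) {0<..<1}"
    by (rule has_integral_diff)
  moreover have "(\<Prod>i<Suc m. c - real i) = c * (\<Prod>i<m. c - 1 - real i)"
    by (subst prod.lessThan_Suc_shift) (simp add: algebra_simps)
  moreover have "c - 1 + a - real m + 1 = c + a - real (Suc m) + 1" by simp
  ultimately show ?case by (simp only: add_diff_cancel_right' power_Suc minus_mult_left[symmetric]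
      minus_mult_right[symmetric] diff_0 mult_1_left ac_simps)
qed

text \<open>The monomial of degree \<open>i\<close> in \<open>R\<close> is a moment with
  \<open>c = i - 1\<close>, the shift by one coming from \<open>x powr (A - 1)\<close>. For
  \<open>i = 0\<close> the falling factorial of -1 is \<open>fact m\<close> up to a sign that
  cancels.\<close>

lemma has_integral_poly_mult_rodrigues_poly:
  fixes A b :: real
  assumes "A > 0" "b > -1" and deg: "degree R \<le> m"
  shows "((\<lambda>x. x powr (A - 1) * (1 - x) powr b * (poly R x * poly (rodrigues_poly (A + real m) (b + real m) m) x))
    has_integral poly R 0 * (fact m * Beta A (b + real m + 1))) {0<..<1}"
proof -
  let ?Q = "rodrigues_poly (A + real m) (b + real m) m"
  let ?f = "\<lambda>i x. coeff R i * (x powr (real i - 1 + (A + real m) - real m) *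
      (1 - x) powr (b + real m - real m) * poly ?Q x)"
  let ?I = "\<lambda>i. coeff R i * ((-1) ^ m * (\<Prod>j<m. real i - 1 - real j) *
      Beta (real i - 1 + (A + real m) - real m + 1) (b + real m + 1))"
  have int: "((\<lambda>x. \<Sum>i\<le>m. ?f i x) has_integral (\<Sum>i\<le>m. ?I i)) {0<..<1}"
    using assms by (intro has_integral_sum has_integral_mult_right has_integral_rodrigues_moment) auto
  have eq: "(\<Sum>i\<le>m. ?f i x) = x powr (A - 1) * (1 - x) powr b * (poly R x * poly ?Q x)"
    if "x \<in> {0<..<1}" for x
  proof -
    have "x powr (real i - 1 + (A + real m) - real m) = x powr (A - 1) * x ^ i" for i
      using that by (simp add: powr_add powr_diff powr_realpow)
    then have "?f i x = x powr (A - 1) * (1 - x) powr b * poly ?Q x * (coeff R i * x ^ i)" for i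
      by (simp only: add_diff_cancel_right' ac_simps)
    moreover have "poly R x = (\<Sum>i\<le>m. coeff R i * x ^ i)"
      unfolding poly_altdef using deg
      by (intro sum.mono_neutral_left) (auto simp: coeff_eq_0)
    ultimately show ?thesis
      by (simp only: sum_distrib_left[symmetric]) (simp only: ac_simps)
  qed
  have "(\<Sum>i\<le>m. ?I i) = (\<Sum>i\<in>{0}. ?I i)"
  proof (rule sum.mono_neutral_right)
    show "\<forall>i\<in>{..m} - {0}. ?I i = 0"
    proof
      fix i assume i: "i \<in> {..m} - {0}"
      \<comment> \<open>The factor with \<open>j = i - 1\<close> is zero; \<open>i - 1\<close> is a
        true difference since \<open>i\<close> is positive.\<close>
      then have "i - 1 \<in> {..<m}" "real i - 1 - real (i - 1) = 0" by auto
      then have "(\<Prod>j<m. real i - 1 - real j) = 0"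
        using prod_zero[of "{..<m}" "\<lambda>j. real i - 1 - real j"] by blast
      then show "?I i = 0" by simp
    qed
  qed auto
  moreover have "(-1) ^ j * (\<Prod>i<j. - 1 - real i) = fact j" for j
    by (induction j) (auto simp: algebra_simps)
  ultimately have "(\<Sum>i\<le>m. ?I i) = poly R 0 * (fact m * Beta A (b + real m + 1))"
    by (simp add: poly_0_coeff_0)
  then show ?thesis
    using has_integral_eq[OF eq int] by simp
qed

section \<open>Integrability, Gamma factors and the substitution\<close>

text \<open>The change of variables needs absolute integrability. Each monomial gives a nonnegative
  Beta integrand, for which the known integral suffices.\<close>

lemma absolutely_integrable_Beta_poly:
  fixes a b :: real
  assumes "a > 0" "b > 0"
  shows "(\<lambda>x. x powr (a - 1) * (1 - x) powr (b - 1) * poly p x) absolutely_integrable_on {0<..<1}"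
proof -
  have "(\<lambda>x. x powr (a + real i - 1) * (1 - x) powr (b - 1)) absolutely_integrable_on {0<..<1}" for i
    using has_integral_Beta_real[of "a + real i" b] assms
    by (intro nonnegative_absolutely_integrable_1)
       (auto simp: has_integral_Icc_iff_Ioo has_integral_integrable)
  then have "(\<lambda>x. \<Sum>i\<le>degree p. coeff p i *\<^sub>R (x powr (a + real i - 1) * (1 - x) powr (b - 1)))
      absolutely_integrable_on {0<..<1}"
    by (intro absolutely_integrable_sum absolutely_integrable_scaleR_left) auto
  moreover have "(\<Sum>i\<le>degree p. coeff p i *\<^sub>R (x powr (a + real i - 1) * (1 - x) powr (b - 1)))
      = x powr (a - 1) * (1 - x) powr (b - 1) * poly p x" if "x \<in> {0<..<1}" for x
  proof -
    have "x powr (a + real i - 1) = x powr (a - 1) * x ^ i" for i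
      using that by (simp add: powr_add powr_diff powr_realpow)
    then show ?thesis
      by (simp add: poly_altdef sum_distrib_left ac_simps)
  qed
  ultimately show ?thesis
    by (subst set_integrable_cong[OF refl refl, where f' = "\<lambda>x. \<Sum>i\<le>degree p.
        coeff p i *\<^sub>R (x powr (a + real i - 1) * (1 - x) powr (b - 1))"]) auto
qed

lemma prod_falling_eq_Gamma:
  fixes A :: real
  assumes "A > 0"
  shows "(\<Prod>i<m. A + real m - real i) * Gamma (A + 1) = Gamma (A + real m + 1)"
proof (induction m)
  case (Suc m)
  have "(\<Prod>i<Suc m. A + real (Suc m) - real i) = (A + real m + 1) * (\<Prod>i<m. A + real m - real i)"
    by (subst prod.lessThan_Suc_shift) (simp add: algebra_simps)
  then show ?case
    using Suc Gamma_plus1[of "A + real m + 1"] assms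
    by (auto simp: algebra_simps nonpos_Ints_def)
qed simp

lemma LBINT_exp_minus_substitution:
  fixes f :: "real \<Rightarrow> real"
  assumes [measurable]: "f \<in> borel_measurable borel"
    and "f absolutely_integrable_on {0<..<1}" "integral {0<..<1} f = I"
  shows "interval_lebesgue_integrable lborel 0 \<infinity> (\<lambda>t. exp (- t) * f (exp (- t)))
    \<and> (LBINT t=0..\<infinity>. exp (- t) * f (exp (- t))) = I"
proof -
  have img: "(\<lambda>t. exp (- t)) ` {0<..} = {0<..<1::real}"
  proof (intro equalityI subsetI)
    fix x :: real assume "x \<in> {0<..<1}"
    then show "x \<in> (\<lambda>t. exp (- t)) ` {0<..}" by (intro image_eqI[of _ _ "- ln x"]) auto
  qed auto
  have "(\<lambda>t. \<bar>- exp (- t)\<bar> * f (exp (- t))) absolutely_integrable_on {0<..}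
      \<and> integral {0<..} (\<lambda>t. \<bar>- exp (- t)\<bar> * f (exp (- t))) = I"
    by (subst has_absolute_integral_change_of_variables_1')
       (use assms in \<open>auto simp: img inj_on_def intro!: derivative_eq_intros\<close>)
  then have *: "(\<lambda>t. exp (- t) * f (exp (- t))) absolutely_integrable_on {0<..}"
      "integral {0<..} (\<lambda>t. exp (- t) * f (exp (- t))) = I"
    by auto
  \<comment> \<open>Borel measurability of \<open>f\<close> allows the passage from the completed
    measure to \<open>lborel\<close>.\<close>
  have "set_integrable lborel {0<..} (\<lambda>t. exp (- t) * f (exp (- t)))"
    using *(1) unfolding set_integrable_def by (subst (asm) integrable_completion) simp_all
  then show ?thesis
    using *(2) set_borel_integral_eq_integral(2)[of "{0<..}" "\<lambda>t. exp (- t) * f (exp (- t))"]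
    by (simp add: interval_integrable_to_infinity_eq interval_integral_to_infinity_eq zero_ereal_def)
qed

section \<open>Orthogonality and the norm\<close>

lemma exp_jacobi_orthogonality_le:
  fixes \<alpha> \<beta> :: real and n k l :: nat
  assumes "\<alpha> > -1" "\<beta> > -1" "1 \<le> k" "k \<le> l" "l \<le> n"
  shows "interval_lebesgue_integrable lborel 0 \<infinity>
           (\<lambda>t. exp (- \<alpha> * t) * (1 - exp (- t)) powr \<beta> * exp_jacobi n k \<alpha> \<beta> t * exp_jacobi n l \<alpha> \<beta> t)
       \<and> (LBINT t=0..\<infinity>. exp (- \<alpha> * t) * (1 - exp (- t)) powr \<beta> * exp_jacobi n k \<alpha> \<beta> t * exp_jacobi n l \<alpha> \<beta> t)
         = 1 / (\<alpha> + 2 * real k)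
           * (Gamma (\<alpha> + real n + real k + 1) * Gamma (\<beta> + real n - real k + 1)
              / (fact (n - k) * Gamma (\<alpha> + \<beta> + real n + real k + 1)))
           * (if k = l then 1 else 0)"
proof -
  define A m where "A = \<alpha> + 2 * real k" and "m = n - k"
  have A: "A > 0" and m: "real m = real n - real k"
    using assms by (auto simp: A_def m_def of_nat_diff)
  define Pk Pl where "Pk = alt_jacobi n k (\<alpha> - 1) \<beta>" and "Pl = alt_jacobi n l (\<alpha> - 1) \<beta>"
  define Qk where "Qk = rodrigues_poly (A + real m) (\<beta> + real m) m"
  define Ql where "Ql = rodrigues_poly (\<alpha> + real n + real l) (\<beta> + real n - real l) (n - l)"
  \<comment> \<open>What is left of the integrand once \<open>x ^ (2 * k)\<close> has joined the
    weight and \<open>Qk\<close> is split off. The order \<open>k \<le> l\<close> makes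
    \<open>l - k\<close> a true difference and bounds the degree by
    \<open>(l - k) + (n - l) = m\<close>.\<close>
  define R where "R = smult (1 / (fact m * fact (n - l))) (monom 1 (l - k) * Ql)"
  define f where "f x = x powr (\<alpha> - 1) * (1 - x) powr \<beta> * (poly Pk x * poly Pl x)" for x
  have Pk: "poly Pk x = x ^ k * poly Qk x / fact m" if "x \<in> {0<..<1}" for x
  proof -
    have e: "\<alpha> + real n + real k = A + real m" "\<beta> + real n - real k = \<beta> + real m"
      by (simp_all add: A_def m)
    then show ?thesis
      using that assms poly_alt_jacobi_rodrigues[of k n x \<alpha> \<beta>, unfolded e, folded m_def]
      unfolding Pk_def Qk_def by simp
  qed
  have Pl: "poly Pl x = x ^ l * poly Ql x / fact (n - l)" if "x \<in> {0<..<1}" for x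
    using that assms poly_alt_jacobi_rodrigues[of l n x \<alpha> \<beta>] by (simp add: Pl_def Ql_def)
  have f: "f x = x powr (A - 1) * (1 - x) powr \<beta> * (poly R x * poly Qk x)" if "x \<in> {0<..<1}" for x
  proof -
    have "x ^ l = x ^ k * x ^ (l - k)" using assms by (simp flip: power_add)
    moreover have "x powr (A - 1) = x powr (\<alpha> - 1) * x ^ k * x ^ k"
    proof -
      have "x powr (A - 1) = x powr (\<alpha> - 1 + real k + real k)"
        by (simp add: A_def algebra_simps)
      then show ?thesis using that by (simp only: powr_add powr_realpow greaterThanLessThan_iff)
    qed
    ultimately show ?thesis
      unfolding f_def Pk[OF that] Pl[OF that] by (simp add: R_def poly_monom)
  qed
  have "degree R \<le> m"
  proof -
    have "degree R \<le> degree (monom (1::real) (l - k)) + degree Ql"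
      unfolding R_def using degree_smult_le degree_mult_le le_trans by blast
    also have "\<dots> \<le> (l - k) + (n - l)"
      unfolding Ql_def by (intro add_mono degree_monom_le degree_rodrigues_poly)
    finally show ?thesis using assms by (simp add: m_def)
  qed
  from has_integral_poly_mult_rodrigues_poly[OF A assms(2) this]
  have "((\<lambda>x. x powr (A - 1) * (1 - x) powr \<beta> * (poly R x * poly Qk x)) has_integral
      poly R 0 * (fact m * Beta A (\<beta> + real m + 1))) {0<..<1}"
    by (simp add: Qk_def)
  then have "(f has_integral poly R 0 * (fact m * Beta A (\<beta> + real m + 1))) {0<..<1}"
    by (rule has_integral_eq[rotated]) (simp add: f)
  then have f_integral: "integral {0<..<1} f = poly R 0 * (fact m * Beta A (\<beta> + real m + 1))"
    by (rule integral_unique)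
  have "f absolutely_integrable_on {0<..<1}"
    using absolutely_integrable_Beta_poly[of A "\<beta> + 1" "R * Qk"] A assms(2)
    by (subst set_integrable_cong[OF refl refl f]) auto
  moreover have [measurable]: "poly p \<in> borel_measurable borel" for p :: "real poly"
    by (intro borel_measurable_continuous_onI continuous_intros)
  then have "f \<in> borel_measurable borel"
    unfolding f_def by measurable
  ultimately have "interval_lebesgue_integrable lborel 0 \<infinity> (\<lambda>t. exp (- t) * f (exp (- t)))
      \<and> (LBINT t=0..\<infinity>. exp (- t) * f (exp (- t))) = poly R 0 * (fact m * Beta A (\<beta> + real m + 1))"
    using f_integral by (intro LBINT_exp_minus_substitution) auto
  moreover have "exp (- t) * f (exp (- t)) =
      exp (- \<alpha> * t) * (1 - exp (- t)) powr \<beta> * exp_jacobi n k \<alpha> \<beta> t * exp_jacobi n l \<alpha> \<beta> t" for t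
  proof -
    \<comment> \<open>The Jacobian compensates for the parameter shift
      \<open>\<alpha> - 1\<close>.\<close>
    have "exp (- t) * exp (- t) powr (\<alpha> - 1) = exp (- \<alpha> * t)"
      by (simp add: powr_def algebra_simps flip: exp_add)
    then show ?thesis by (simp add: f_def exp_jacobi_def Pk_def Pl_def)
  qed
  moreover have "poly R 0 * (fact m * Beta A (\<beta> + real m + 1)) = 1 / (\<alpha> + 2 * real k)
      * (Gamma (\<alpha> + real n + real k + 1) * Gamma (\<beta> + real n - real k + 1)
         / (fact (n - k) * Gamma (\<alpha> + \<beta> + real n + real k + 1)))
      * (if k = l then 1 else 0)"
  proof (cases "k = l")
    case False
    \<comment> \<open>The factor \<open>x ^ (l - k)\<close> of \<open>R\<close> vanishes at
      0.\<close>
    then show ?thesis using assms by (simp add: R_def poly_monom)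
  next
    case True
    then have "Ql = Qk" unfolding Ql_def Qk_def A_def m by (simp add: m_def algebra_simps)
    then have R0: "poly R 0 = (\<Prod>i<m. A + real m - real i) / (fact m * fact m)"
      using True unfolding R_def Qk_def by (simp add: poly_0_rodrigues_poly) (simp add: m_def)
    have "Gamma (A + 1) = A * Gamma A" "Gamma A > 0"
      using A Gamma_plus1[of A] by (auto simp: nonpos_Ints_def Gamma_real_pos)
    \<comment> \<open>The Beta integral contains \<open>Gamma A\<close> while the product telescopes
      from \<open>Gamma (A + 1)\<close>; the quotient is the source of
      \<open>1 / (\<alpha> + 2 * k)\<close>.\<close>
    then have prod: "(\<Prod>i<m. A + real m - real i) * Gamma A = Gamma (A + real m + 1) / A"
      using prod_falling_eq_Gamma[OF A, of m] A by (simp add: field_simps)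
    have e: "A + real m + 1 = \<alpha> + real n + real k + 1"
        "A + (\<beta> + real n - real k + 1) = \<alpha> + \<beta> + real n + real k + 1"
        "\<beta> + real m + 1 = \<beta> + real n - real k + 1"
      by (simp_all add: A_def m)
    have "poly R 0 * (fact m * Beta A (\<beta> + real m + 1)) =
        ((\<Prod>i<m. A + real m - real i) * Gamma A) * Gamma (\<beta> + real m + 1)
        / (fact m * Gamma (A + (\<beta> + real m + 1)))"
      unfolding R0 Beta_def by simp
    also have "\<dots> = 1 / A * (Gamma (A + real m + 1) * Gamma (\<beta> + real m + 1)
        / (fact m * Gamma (A + (\<beta> + real m + 1))))"
      unfolding prod by simp
    finally show ?thesis using True unfolding e by (simp add: A_def m_def)
  qed
  ultimately show ?thesis by simp
qed

theorem mainTheorem5: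
  fixes \<alpha> \<beta> :: real and n k l :: nat
  assumes "\<alpha> > -1" and "\<beta> > -1" and "n \<ge> 1"
    and "1 \<le> k" and "k \<le> n" and "1 \<le> l" and "l \<le> n"
  shows "interval_lebesgue_integrable lborel 0 \<infinity>
           (\<lambda>t. exp (- \<alpha> * t) * (1 - exp (- t)) powr \<beta> * exp_jacobi n k \<alpha> \<beta> t * exp_jacobi n l \<alpha> \<beta> t)
       \<and> (LBINT t=0..\<infinity>. exp (- \<alpha> * t) * (1 - exp (- t)) powr \<beta> * exp_jacobi n k \<alpha> \<beta> t * exp_jacobi n l \<alpha> \<beta> t)
         = 1 / (\<alpha> + 2 * real k)
           * (Gamma (\<alpha> + real n + real k + 1) * Gamma (\<beta> + real n - real k + 1)
              / (fact (n - k) * Gamma (\<alpha> + \<beta> + real n + real k + 1)))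
           * (if k = l then 1 else 0)"
proof (cases "k \<le> l")
  case True
  then show ?thesis using exp_jacobi_orthogonality_le assms by blast
next
  case False
  then have "l \<le> k" "k \<noteq> l" by auto
  \<comment> \<open>The integrand is symmetric in \<open>k\<close> and \<open>l\<close>, and both
    right-hand sides are 0, so their different constants do not matter.\<close>
  then show ?thesis
    using exp_jacobi_orthogonality_le[of \<alpha> \<beta> l k n] assms by (simp add: ac_simps)
qed

end
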